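(* Let $r,s,k$ be positive integers with $r+s$ dividing $k$, and let $q\ge 0$ be an integer. Suppose $n\ge k$ and $$n\ge\max\left\{k\left\lfloor\frac{q-r}{r+s}+\frac{rsk}{(r+s)^2}\right\rfloor+\frac{sk}{r+s}+\frac{r}{s},\; k\left\lfloor\frac{q-s}{r+s}+\frac{rsk}{(r+s)^2}\right\rfloor+\frac{rk}{r+s}+\frac{s}{r}\right\}.$$ Then every function $f:[n]\to\{-r,s\}$ with $|f([n])|\le q$ has a $k$-block $B\subseteq[n]$ with $f(B)=0$.
   Context: $[n]=\{1,\ldots,n\}$; for $Y\subseteq[n]$, $f(Y)=\sum_{y\in Y}f(y)$. A $k$-block is a set of $k$ consecutive integers. *)

theory Defs
  imports Complex_Main
begin

(* Blocks are used only as subsets of {1..n}, so consecutive natural numbers suffice. *)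
definition is_block :: "nat \<Rightarrow> nat set \<Rightarrow> bool" where
  "is_block k B \<longleftrightarrow> (\<exists>a. B = {a..<a + k})"

end

theory Submission
  imports Defs
begin

text \<open>
  All values of \<open>f\<close> are congruent to \<open>s\<close> modulo \<open>r + s\<close>, so the sums over \<open>k\<close>-blocks are multiples
  of \<open>r + s\<close>, and shifting a block by one changes its sum by \<open>0\<close> or \<open>\<plusminus>(r + s)\<close>. Without a zero-sum
  block all block sums therefore have the same sign, say positive (the other case is \<open>- f\<close> with
  \<open>r\<close> and \<open>s\<close> exchanged). Writing \<open>n = t k + u\<close> with \<open>u < k\<close>, the first \<open>t\<close> disjoint blocks contribute
  at least \<open>t (r + s)\<close>, and the remaining \<open>u\<close> points, lying in the last block, cannot have a very
  negative sum; together this exceeds \<open>q\<close>.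
\<close>

lemma block_sum_dvd:
  fixes r s k :: nat and f :: "nat \<Rightarrow> int"
  assumes "(r + s) dvd k" and "f ` {a..<a + k} \<subseteq> {- int r, int s}"
  shows "int (r + s) dvd sum f {a..<a + k}"
proof -
  have "int (r + s) dvd f i - int s" if "i \<in> {a..<a + k}" for i
  proof -
    have "f i = - int r \<or> f i = int s" using assms(2) that by blast
    \<comment> \<open>The witness \<open>-1\<close> serves the value \<open>- r\<close>, for which
      the difference is \<open>- (r + s)\<close>.\<close>
    then show ?thesis by (auto simp: dvd_def intro: exI[of _ "-1"])
  qed
  then have "int (r + s) dvd (\<Sum>i=a..<a + k. f i - int s)" by (intro dvd_sum) auto
  moreover have "sum f {a..<a + k} = (\<Sum>i=a..<a + k. f i - int s) + int k * int s"
    by (simp add: sum_subtractf)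
  moreover have "int (r + s) dvd int k" using assms(1) by (simp only: int_dvd_int_iff)
  ultimately show ?thesis by (metis dvd_add dvd_mult2)
qed

lemma block_sum_shift:
  fixes f :: "nat \<Rightarrow> int"
  shows "sum f {Suc a..<Suc a + k} = sum f {a..<a + k} + f (a + k) - f a"
proof -
  have "sum f {a..<Suc (a + k)} = f a + sum f {Suc a..<Suc (a + k)}"
    by (rule sum.atLeast_Suc_lessThan) simp
  moreover have "sum f {a..<Suc (a + k)} = sum f {a..<a + k} + f (a + k)" by simp
  ultimately show ?thesis by simp
qed

text \<open>A discrete intermediate value argument: a positive block sum is at least
  \<open>r + s\<close> by divisibility, and a shift lowers it by at most \<open>r + s\<close>. The
  next sum is thus nonnegative, and \<open>nz\<close> excludes zero.\<close>

lemma block_sums_ge: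
  fixes r s k n :: nat and f :: "nat \<Rightarrow> int"
  assumes dvd: "(r + s) dvd k" and f: "f ` {1..n} \<subseteq> {- int r, int s}"
    and nz: "\<And>a. 1 \<le> a \<Longrightarrow> a + k \<le> Suc n \<Longrightarrow> sum f {a..<a + k} \<noteq> 0"
    and pos: "sum f {1..<1 + k} > 0"
    and a: "1 \<le> a" "a + k \<le> Suc n"
  shows "sum f {a..<a + k} \<ge> int (r + s)"
proof -
  have gap: "sum f {b..<b + k} \<ge> int (r + s)"
    if "1 \<le> b" "b + k \<le> Suc n" "sum f {b..<b + k} > 0" for b
  proof -
    have "f ` {b..<b + k} \<subseteq> f ` {1..n}" using that by (intro image_mono) auto
    then have "int (r + s) dvd sum f {b..<b + k}" using f
      by (intro block_sum_dvd[OF dvd]) (rule order_trans)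
    then show ?thesis using that(3) by (rule zdvd_imp_le)
  qed
  from a have "sum f {a..<a + k} > 0"
  proof (induction a rule: dec_induct)
    case base
    then show ?case using pos by simp
  next
    case (step b)
    have "sum f {b..<b + k} \<ge> int (r + s)" using gap[of b] step by simp
    moreover have "f b \<in> {- int r, int s}" "f (b + k) \<in> {- int r, int s}"
      using f[THEN subsetD, OF imageI, of b] f[THEN subsetD, OF imageI, of "b + k"] step by auto
    ultimately have "sum f {Suc b..<Suc b + k} \<ge> 0"
      unfolding block_sum_shift by (elim insertE emptyE) simp_all
    then show ?case using nz[of "Suc b"] step by simp
  qed
  then show ?thesis using gap a by blast
qed

lemma sum_consecutive_blocks_ge:
  fixes f :: "nat \<Rightarrow> int"
  assumes "\<And>a. 1 \<le> a \<Longrightarrow> a + k \<le> Suc n \<Longrightarrow> sum f {a..<a + k} \<ge> d"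
    and "t * k \<le> n"
  shows "sum f {1..<1 + t * k} \<ge> int t * d"
  using assms(2)
proof (induction t)
  case (Suc t)
  have "sum f {1..<1 + Suc t * k} = sum f {1..<1 + t * k} + sum f {1 + t * k..<1 + t * k + k}"
    by (subst sum.atLeastLessThan_concat) (auto simp: algebra_simps)
  moreover have "sum f {1 + t * k..<1 + t * k + k} \<ge> d" using Suc.prems by (intro assms(1)) auto
  ultimately show ?case using Suc by (simp add: algebra_simps)
qed simp

text \<open>The first bound holds because the \<open>k - u\<close> points of the last block before
  the tail contribute at most \<open>s\<close> each; it is strong for large \<open>u\<close>.
  Balancing it against the trivial bound \<open>- r * u\<close> gives the second, which is uniform
  in \<open>u\<close>.\<close>

lemma tail_bounds:
  fixes r s k m n u :: nat and f :: "nat \<Rightarrow> int"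
  assumes "r > 0" "k = (r + s) * m" and u: "u \<le> k" "k \<le> n"
    and f: "f ` {1..n} \<subseteq> {- int r, int s}"
    and last: "sum f {Suc n - k..<Suc n} \<ge> int (r + s)"
  shows "sum f {Suc n - u..<Suc n} \<ge> int s * int u - int (r + s) * (int s * int m - 1)"
    and "sum f {Suc n - u..<Suc n} \<ge> - int r * (int s * int m - 1)"
proof -
  let ?X = "sum f {Suc n - u..<Suc n}"
  have bd: "- int r \<le> f i \<and> f i \<le> int s" if "i \<in> {1..n}" for i
  proof -
    have "f i = - int r \<or> f i = int s" using f that by blast
    then show ?thesis by auto
  qed
  have "sum f {Suc n - k..<Suc n} = sum f {Suc n - k..<Suc n - u} + ?X"
    using u by (subst sum.atLeastLessThan_concat) auto
  moreover have "sum f {Suc n - k..<Suc n - u} \<le> int (card {Suc n - k..<Suc n - u}) * int s"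
  proof (rule sum_bounded_above)
    fix i assume "i \<in> {Suc n - k..<Suc n - u}"
    then have "i \<in> {1..n}" using u by auto
    then show "f i \<le> int s" using bd by blast
  qed
  moreover have "int (card {Suc n - k..<Suc n - u}) = int k - int u" using u by simp
  ultimately have "?X \<ge> int (r + s) - (int k - int u) * int s" using last by simp
  then show 1: "?X \<ge> int s * int u - int (r + s) * (int s * int m - 1)"
    using assms(2) by (simp add: algebra_simps)
  have "?X \<ge> int (card {Suc n - u..<Suc n}) * (- int r)"
  proof (rule sum_bounded_below)
    fix i assume "i \<in> {Suc n - u..<Suc n}"
    then have "i \<in> {1..n}" using u by auto
    then show "- int r \<le> f i" using bd by blast
  qed
  then have 2: "?X \<ge> - (int r * int u)" using u by (simp add: algebra_simps)
  \<comment> \<open>The convex combination of both lower bounds in which \<open>u\<close> cancels.\<close>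
  have "int s * ?X + int r * ?X
      \<ge> int s * (- (int r * int u)) + int r * (int s * int u - int (r + s) * (int s * int m - 1))"
    using 1 2 by (intro add_mono mult_left_mono) auto
  then have "int (r + s) * ?X \<ge> int (r + s) * (- int r * (int s * int m - 1))"
    by (simp add: algebra_simps)
  then show "?X \<ge> - int r * (int s * int m - 1)"
    by (rule mult_left_le_imp_le) (use assms(1) in simp)
qed

text \<open>The number \<open>t\<close> of full blocks is compared with the floor \<open>F\<close>
  in the bound on \<open>n\<close>: more than \<open>F\<close> blocks outweigh any tail, exactly
  \<open>F\<close> blocks force a long tail, and fewer contradict the size of
  \<open>n\<close>.\<close>

lemma sum_gt_if_blocks_positive:
  fixes r s k q n :: nat and f :: "nat \<Rightarrow> int"
  assumes "r > 0" "s > 0" "k > 0" and dvd: "(r + s) dvd k" and "n \<ge> k"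
    and n: "real n \<ge> real k * of_int \<lfloor>(real q - real r) / (real r + real s)
          + real r * real s * real k / (real r + real s)^2\<rfloor>
        + real s * real k / (real r + real s) + real r / real s"
    and f: "f ` {1..n} \<subseteq> {- int r, int s}"
    and nz: "\<And>a. 1 \<le> a \<Longrightarrow> a + k \<le> Suc n \<Longrightarrow> sum f {a..<a + k} \<noteq> 0"
    and pos: "sum f {1..<1 + k} > 0"
  shows "sum f {1..n} > int q"
proof -
  obtain m where m: "k = (r + s) * m" using dvd by blast
  define t u where "t = n div k" and "u = n mod k"
  have n_eq: "n = t * k + u" and "u < k" using \<open>k > 0\<close> by (auto simp: t_def u_def)
  define d where "d = int r + int s"
  have "d > 0" using assms(1) by (simp add: d_def)
  \<comment> \<open>Since \<open>k = d * m\<close>, the term with denominator \<open>d^2\<close>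
    reduces to \<open>r * s * m / d\<close>, so the real floor is an integer division by
    \<open>d\<close>.\<close>
  define F where "F = (int q - int r + int r * int s * int m) div d"
  have "(real q - real r) / (real r + real s) + real r * real s * real k / (real r + real s)^2
      = of_int (int q - int r + int r * int s * int m) / of_int d"
    using assms(1) by (simp add: m d_def divide_simps power2_eq_square add_eq_0_iff)
  then have F: "\<lfloor>(real q - real r) / (real r + real s)
      + real r * real s * real k / (real r + real s)^2\<rfloor> = F"
    unfolding F_def by (simp only: floor_divide_of_int_eq)
  have sk: "real s * real k / (real r + real s) = real s * real m"
    using assms(1) by (simp add: m field_simps)
  \<comment> \<open>Multiplying by \<open>s\<close> clears the fraction \<open>r / s\<close>, so the
    hypothesis can be moved to the integers.\<close>
  have "real n * real s \<ge> (real k * of_int F + real s * real m + real r / real s) * real s"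
    using n unfolding F sk by (rule mult_right_mono) simp
  then have "real n * real s \<ge> (real k * of_int F + real s * real m) * real s + real r"
    using assms(2) by (simp add: algebra_simps)
  then have "of_int (int n * int s) \<ge> (of_int ((int k * F + int s * int m) * int s + int r) :: real)"
    by simp
  then have nF: "int n * int s \<ge> (int k * F + int s * int m) * int s + int r"
    by (simp only: of_int_le_iff)
  \<comment> \<open>The final \<open>+ 1\<close>, from strictness of the remainder bound over the
    integers, makes the conclusion \<open>> q\<close> strict.\<close>
  have F_lt: "(F + 1) * d \<ge> int q - int r + int r * int s * int m + 1"
  proof -
    let ?A = "int q - int r + int r * int s * int m"
    have "?A = F * d + ?A mod d" unfolding F_def by (rule div_mult_mod_eq[symmetric])
    moreover have "?A mod d < d" using \<open>d > 0\<close> by (rule pos_mod_bound)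
    ultimately show ?thesis unfolding distrib_right by linarith
  qed
  have ge: "sum f {a..<a + k} \<ge> d" if "1 \<le> a" "a + k \<le> Suc n" for a
    using block_sums_ge[OF dvd f nz pos that] by (simp add: d_def)
  have "sum f {Suc n - k..<Suc n} \<ge> int (r + s)"
    using ge[of "Suc n - k"] assms(5) by (simp add: d_def)
  note tail = tail_bounds[OF assms(1) m less_imp_le[OF \<open>u < k\<close>] assms(5) f this]
  have split: "sum f {1..n} = sum f {1..<1 + t * k} + sum f {Suc n - u..<Suc n}"
  proof -
    have "Suc n - u = 1 + t * k" using n_eq by simp
    moreover have "{1..n} = {1..<Suc n}" by auto
    moreover have "1 \<le> 1 + t * k" "1 + t * k \<le> Suc n" using n_eq by auto
    ultimately show ?thesis by (simp only: sum.atLeastLessThan_concat)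
  qed
  have head: "sum f {1..<1 + t * k} \<ge> int t * d"
    using ge n_eq by (intro sum_consecutive_blocks_ge) auto
  consider "int t \<ge> F + 1" | "int t = F" | "int t + 1 \<le> F" by linarith
  then show ?thesis
  proof cases
    case 1
    have "int t * d \<ge> (F + 1) * d" using 1 \<open>d > 0\<close> by (intro mult_right_mono) auto
    moreover have "- int r * (int s * int m - 1) = int r - int r * int s * int m"
      by (simp add: algebra_simps)
    ultimately show ?thesis using F_lt split head tail(2) assms(1) by linarith
  next
    case 2
    \<comment> \<open>With \<open>t = F\<close>, the bound on \<open>n\<close> becomes a lower bound
      on \<open>u\<close>. It raises the first tail bound to \<open>d\<close> above the uniform one,
      which makes up for the one block fewer than in the previous case.\<close>
    have "int u * int s \<ge> int s * int m * int s + int r"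
      using nF 2 by (simp add: n_eq algebra_simps)
    moreover have "int (r + s) * (int s * int m - 1)
        = int r * int s * int m + int s * int m * int s - d"
      by (simp add: d_def algebra_simps)
    moreover have "(F + 1) * d = int t * d + d" using 2 by (simp add: algebra_simps)
    ultimately show ?thesis using F_lt split head tail(1) by (simp add: mult.commute)
  next
    case 3
    have "int k * (int t + 1) \<le> int k * F" using 3 by (intro mult_left_mono) auto
    then have "int n < int k * F" using n_eq \<open>u < k\<close> by (simp add: algebra_simps)
    moreover have "int n * int s \<ge> int k * F * int s"
    proof -
      have "0 \<le> int s * int m * int s + int r" by simp
      then show ?thesis using nF by (simp only: distrib_right)
    qed
    ultimately show ?thesis using assms(2) by simp
  qed
qed

theorem theorem2p9:
  fixes r s k q n :: nat and f :: "nat \<Rightarrow> int"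
  assumes "r > 0" and "s > 0" and "k > 0"
    and "(r + s) dvd k"
    and "n \<ge> k"
    and "real n \<ge> max
      (real k * of_int \<lfloor>(real q - real r) / (real r + real s)
          + real r * real s * real k / (real r + real s)^2\<rfloor>
        + real s * real k / (real r + real s) + real r / real s)
      (real k * of_int \<lfloor>(real q - real s) / (real r + real s)
          + real r * real s * real k / (real r + real s)^2\<rfloor>
        + real r * real k / (real r + real s) + real s / real r)"
    and "f ` {1..n} \<subseteq> {- int r, int s}"
    and "\<bar>sum f {1..n}\<bar> \<le> int q"
  shows "\<exists>B. is_block k B \<and> B \<subseteq> {1..n} \<and> sum f B = 0"
proof (rule ccontr)
  assume no: "\<not> (\<exists>B. is_block k B \<and> B \<subseteq> {1..n} \<and> sum f B = 0)"
  have nz: "sum f {a..<a + k} \<noteq> 0" if "1 \<le> a" "a + k \<le> Suc n" for a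
  proof -
    have "{a..<a + k} \<subseteq> {1..n}" using that by auto
    then show ?thesis using no unfolding is_block_def by blast
  qed
  show False
  proof (cases "sum f {1..<1 + k} > 0")
    case True
    have "sum f {1..n} > int q"
      using assms(6) by (intro sum_gt_if_blocks_positive[OF assms(1-5) _ assms(7) nz True]) auto
    then show False using assms(8) by simp
  next
    case False
    \<comment> \<open>Exchanging \<open>r\<close> and \<open>s\<close> turns the second term of the
      maximum into the required bound on \<open>n\<close>.\<close>
    let ?g = "\<lambda>i. - f i"
    have "sum ?g {1..n} > int q"
    proof (rule sum_gt_if_blocks_positive[where r = s and s = r and k = k])
      show "(s + r) dvd k" using assms(4) by (simp add: add.commute)
      show "?g ` {1..n} \<subseteq> {- int s, int r}" using assms(7) by (auto simp: image_subset_iff)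
      show "sum ?g {a..<a + k} \<noteq> 0" if "1 \<le> a" "a + k \<le> Suc n" for a
        using nz[OF that] by (simp add: sum_negf)
      show "sum ?g {1..<1 + k} > 0"
        using nz[of 1] False assms(5) by (simp add: sum_negf)
      show "real k * of_int \<lfloor>(real q - real s) / (real s + real r)
          + real s * real r * real k / (real s + real r)^2\<rfloor>
        + real r * real k / (real s + real r) + real s / real r \<le> real n"
        using assms(6) by (simp add: add.commute[of "real s" "real r"] mult.commute[of "real s" "real r"])
    qed (use assms in auto)
    then show False using assms(8) by (simp add: sum_negf)
  qed
qed

end
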